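(* (Alternation Theorem, one vs. all.) For every integer $\ell \ge 1$ there is a first-order $\tau_{\mathsf{ord}}$-sentence $\varphi_\ell$ in prenex form, with a quantifier prefix that strictly alternates between $\exists$ and $\forall$ and ends with $\forall$, consisting of $q^*(\ell)+2$ quantifiers (and so at most $\log(\ell)+4$ quantifiers), which is true in $L_\ell$ and false in $L_m$ for every $m \ge 1$ with $m \neq \ell$.
   Context: Let $\tau_{\mathsf{ord}} = \langle <; \mathsf{min}, \mathsf{max}\rangle$ with $<$ binary and $\mathsf{min},\mathsf{max}$ constants. For $m \ge 1$, $L_m$ denotes the linear order on $m+1$ elements with $\mathsf{min},\mathsf{max}$ interpreted as its first and last elements ($m$ is its length); these are all the linear orders considered. $\log$ is base 2. The functions $q^*_\forall, q^*_\exists:\mathbb{N}_{\ge1}\to\mathbb{N}$ (the number of rounds used by the paper's "closest-to-midpoint with alternation" Spoiler strategy for separating lengths $\le \ell$ from lengths $>\ell$, starting with a universal, resp. existential, move) satisfy and are determined by: $q^*_\forall(1)=1$, $q^*_\exists(1)=2$, $q^*_\forall(2)=2$; $q^*_\exists(2m)=q^*_\forall(m)+1$ and $q^*_\exists(2m+1)=q^*_\forall(m+1)+1$ for $m\ge1$; $q^*_\forall(2m)=q^*_\exists(m)+1$ for $m\ge2$; $q^*_\forall(2m+1)=q^*_\exists(m)+1$ for $m\ge1$. Finally $q^*(\ell)=\min(q^*_\forall(\ell),q^*_\exists(\ell))$. *)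

theory Defs
  imports Complex_Main
begin

text \<open>First-order logic with equality over the vocabulary with one binary relation symbol
  (strict order) and two constant symbols. Variables are named by natural numbers.\<close>

datatype trm = Var nat | MinC | MaxC

datatype fm =
    Less trm trm
  | Eq trm trm
  | Neg fm
  | Conj fm fm
  | Disj fm fm
  | Ex nat fm
  | All nat fm

fun vars_trm :: "trm \<Rightarrow> nat set" where
  "vars_trm (Var x) = {x}"
| "vars_trm MinC = {}"
| "vars_trm MaxC = {}"

fun free_vars :: "fm \<Rightarrow> nat set" where
  "free_vars (Less s t) = vars_trm s \<union> vars_trm t"
| "free_vars (Eq s t) = vars_trm s \<union> vars_trm t"
| "free_vars (Neg p) = free_vars p"
| "free_vars (Conj p q) = free_vars p \<union> free_vars q"
| "free_vars (Disj p q) = free_vars p \<union> free_vars q"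
| "free_vars (Ex x p) = free_vars p - {x}"
| "free_vars (All x p) = free_vars p - {x}"

definition sentence :: "fm \<Rightarrow> bool" where
  "sentence p \<longleftrightarrow> free_vars p = {}"

record 'a ord_struct =
  universe :: "'a set"
  less_rel :: "'a \<Rightarrow> 'a \<Rightarrow> bool"
  min_elt :: 'a
  max_elt :: 'a

fun val :: "'a ord_struct \<Rightarrow> (nat \<Rightarrow> 'a) \<Rightarrow> trm \<Rightarrow> 'a" where
  "val M e (Var x) = e x"
| "val M e MinC = min_elt M"
| "val M e MaxC = max_elt M"

fun sat :: "'a ord_struct \<Rightarrow> (nat \<Rightarrow> 'a) \<Rightarrow> fm \<Rightarrow> bool" where
  "sat M e (Less s t) \<longleftrightarrow> less_rel M (val M e s) (val M e t)"
| "sat M e (Eq s t) \<longleftrightarrow> val M e s = val M e t"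
| "sat M e (Neg p) \<longleftrightarrow> \<not> sat M e p"
| "sat M e (Conj p q) \<longleftrightarrow> sat M e p \<and> sat M e q"
| "sat M e (Disj p q) \<longleftrightarrow> sat M e p \<or> sat M e q"
| "sat M e (Ex x p) \<longleftrightarrow> (\<exists>a \<in> universe M. sat M (e(x := a)) p)"
| "sat M e (All x p) \<longleftrightarrow> (\<forall>a \<in> universe M. sat M (e(x := a)) p)"

text \<open>Truth of a sentence in a structure; the choice of assignment is immaterial
  (see \<open>models_iff_sat\<close>), so for a sentence falsity is the negation of this.\<close>

definition models :: "'a ord_struct \<Rightarrow> fm \<Rightarrow> bool" where
  "models M p \<longleftrightarrow> (\<forall>e. range e \<subseteq> universe M \<longrightarrow> sat M e p)"

lemma val_cong: "(\<And>x. x \<in> vars_trm t \<Longrightarrow> e x = e' x) \<Longrightarrow> val M e t = val M e' t"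
  by (cases t) auto

lemma sat_cong: "(\<And>x. x \<in> free_vars p \<Longrightarrow> e x = e' x) \<Longrightarrow> sat M e p \<longleftrightarrow> sat M e' p"
proof (induction p arbitrary: e e')
  case (Less s t)
  then have "val M e s = val M e' s" "val M e t = val M e' t" by (auto intro: val_cong)
  then show ?case by simp
next
  case (Eq s t)
  then have "val M e s = val M e' s" "val M e t = val M e' t" by (auto intro: val_cong)
  then show ?case by simp
next
  case (Neg p)
  have "sat M e p = sat M e' p"
    by (rule Neg.IH) (use Neg.prems in simp)
  then show ?case by simp
next
  case (Conj p q)
  have "sat M e p = sat M e' p"
    by (rule Conj.IH(1)) (use Conj.prems in simp)
  moreover have "sat M e q = sat M e' q"
    by (rule Conj.IH(2)) (use Conj.prems in simp)
  ultimately show ?case by simp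
next
  case (Disj p q)
  have "sat M e p = sat M e' p"
    by (rule Disj.IH(1)) (use Disj.prems in simp)
  moreover have "sat M e q = sat M e' q"
    by (rule Disj.IH(2)) (use Disj.prems in simp)
  ultimately show ?case by simp
next
  case (Ex x p)
  have "sat M (e(x := a)) p = sat M (e'(x := a)) p" for a
    by (rule Ex.IH) (use Ex.prems in auto)
  then show ?case by simp
next
  case (All x p)
  have "sat M (e(x := a)) p = sat M (e'(x := a)) p" for a
    by (rule All.IH) (use All.prems in auto)
  then show ?case by simp
qed

lemma models_iff_sat:
  assumes "sentence p" "range e \<subseteq> universe M"
  shows "models M p \<longleftrightarrow> sat M e p"
proof -
  have "sat M e' p \<longleftrightarrow> sat M e p" for e'
    by (rule sat_cong) (use assms(1) in \<open>simp add: sentence_def\<close>)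
  then show ?thesis using assms(2) by (auto simp: models_def)
qed

text \<open>The length \<open>m\<close> counts edges, so \<open>L m\<close> has \<open>m + 1\<close> elements.\<close>

definition L :: "nat \<Rightarrow> nat ord_struct" where
  "L m = \<lparr>universe = {0..m}, less_rel = (<), min_elt = 0, max_elt = m\<rparr>"

datatype quant = Exists | Forall

text \<open>The maximal block of leading quantifiers, outermost first, and what remains below it.\<close>

fun qprefix :: "fm \<Rightarrow> quant list" where
  "qprefix (Ex x p) = Exists # qprefix p"
| "qprefix (All x p) = Forall # qprefix p"
| "qprefix p = []"

fun matrix :: "fm \<Rightarrow> fm" where
  "matrix (Ex x p) = matrix p"
| "matrix (All x p) = matrix p"
| "matrix p = p"

fun quantifier_free :: "fm \<Rightarrow> bool" where
  "quantifier_free (Less s t) \<longleftrightarrow> True"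
| "quantifier_free (Eq s t) \<longleftrightarrow> True"
| "quantifier_free (Neg p) \<longleftrightarrow> quantifier_free p"
| "quantifier_free (Conj p q) \<longleftrightarrow> quantifier_free p \<and> quantifier_free q"
| "quantifier_free (Disj p q) \<longleftrightarrow> quantifier_free p \<and> quantifier_free q"
| "quantifier_free (Ex x p) \<longleftrightarrow> False"
| "quantifier_free (All x p) \<longleftrightarrow> False"

definition prenex :: "fm \<Rightarrow> bool" where
  "prenex p \<longleftrightarrow> quantifier_free (matrix p)"

text \<open>Strict alternation: no two adjacent quantifiers are of the same kind.\<close>

definition alternating :: "quant list \<Rightarrow> bool" where
  "alternating qs \<longleftrightarrow> successively (\<noteq>) qs"

text \<open>Both functions live on the positive integers; the value at \<open>0\<close> is a dummy.
  The recursion by parity is recovered in the lemmas below.\<close>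

function q_forall :: "nat \<Rightarrow> nat" and q_exists :: "nat \<Rightarrow> nat" where
  "q_forall n = (if n \<le> 2 then n else q_exists (n div 2) + 1)"
| "q_exists n = (if n = 0 then 0 else if n = 1 then 2 else q_forall ((n + 1) div 2) + 1)"
  by pat_completeness auto
termination
  by (relation "measure (case_sum id id)") auto

declare q_forall.simps [simp del] q_exists.simps [simp del]

lemma q_base: "q_forall 1 = 1" "q_exists 1 = 2" "q_forall 2 = 2"
  by (simp_all add: q_forall.simps q_exists.simps)

lemma q_exists_even: "m \<ge> 1 \<Longrightarrow> q_exists (2 * m) = q_forall m + 1"
  by (subst q_exists.simps) simp

lemma q_exists_odd: "m \<ge> 1 \<Longrightarrow> q_exists (2 * m + 1) = q_forall (m + 1) + 1"
  by (subst q_exists.simps) simp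

lemma q_forall_even: "m \<ge> 2 \<Longrightarrow> q_forall (2 * m) = q_exists m + 1"
  by (subst q_forall.simps) simp

lemma q_forall_odd: "m \<ge> 1 \<Longrightarrow> q_forall (2 * m + 1) = q_exists m + 1"
  by (subst q_forall.simps) simp

definition q_star :: "nat \<Rightarrow> nat" where
  "q_star l = min (q_forall l) (q_exists l)"

end

theory Submission
  imports Defs
begin

text \<open>An upper bound \<open>t \<le> s + h\<close> on a distance is halved by either quantifier: it says that some
  \<open>w\<close> has \<open>w \<le> s + a\<close> and \<open>t \<le> w + b\<close>, where \<open>h = a + b\<close>, and also that every \<open>z\<close> strictly
  between \<open>s\<close> and \<open>t\<close> has \<open>z \<le> s + a\<close> or \<open>t \<le> z + b\<close>, where \<open>h = a + b + 1\<close>. The two subgoals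
  share the remaining quantifiers, since the position of the next variable relative to the last
  one tells which subgoal is being played. Thus \<open>k\<close> alternating quantifiers ending with \<open>\<forall>\<close> express
  all bounds \<open>h\<close> up to a capacity \<open>F k\<close> with \<open>F (k + 1) = 2 * F k\<close> or \<open>2 * F k + 1\<close>, and \<open>q_star l\<close>
  is the least \<open>k\<close> with \<open>l \<le> F k\<close>. Lower bounds are negated upper bounds, so their prefixes end
  with \<open>\<exists>\<close> and need one more quantifier at the end. A universal variable at the beginning chooses
  between the upper and the lower bounds.\<close>

section \<open>Expressibility with a given quantifier prefix\<close>

fun quantify :: "quant list \<Rightarrow> nat \<Rightarrow> fm \<Rightarrow> fm" where
  "quantify [] n p = p"
| "quantify (Exists # qs) n p = Ex n (quantify qs (Suc n) p)"
| "quantify (Forall # qs) n p = All n (quantify qs (Suc n) p)"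

lemma matrix_quantifier_free: "quantifier_free p \<Longrightarrow> matrix p = p"
  by (cases p) auto

lemma qprefix_quantifier_free: "quantifier_free p \<Longrightarrow> qprefix p = []"
  by (cases p) auto

lemma matrix_quantify: "matrix (quantify qs n p) = matrix p"
  by (induction qs n p rule: quantify.induct) auto

lemma qprefix_quantify: "qprefix (quantify qs n p) = qs @ qprefix p"
  by (induction qs n p rule: quantify.induct) auto

lemma free_vars_quantify: "free_vars (quantify qs n p) = free_vars p - {n..<n + length qs}"
proof -
  have "insert n {Suc n..<Suc (n + k)} = {n..<Suc (n + k)}" for n k :: nat
    by auto
  then show ?thesis
    by (induction qs n p rule: quantify.induct) (simp_all flip: Diff_insert)
qed

lemma L_simps [simp]:
  "universe (L m) = {0..m}" "less_rel (L m) = (<)" "min_elt (L m) = 0" "max_elt (L m) = m"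
  by (simp_all add: L_def)

lemma sat_fun_upd_fresh: "free_vars p \<subseteq> {..<n} \<Longrightarrow> sat M (e(n := a)) p \<longleftrightarrow> sat M e p"
  by (rule sat_cong) auto

lemma val_fun_upd_fresh [simp]: "vars_trm t \<subseteq> {..<n} \<Longrightarrow> val M (e(n := a)) t = val M e t"
  by (rule val_cong) auto

lemma val_L_le: "(\<forall>i. e i \<le> m) \<Longrightarrow> val (L m) e t \<le> m"
  by (cases t) simp_all

lemma sat_quantify_fresh:
  assumes "universe M \<noteq> {}" "free_vars p \<subseteq> {..<n}"
  shows "sat M e (quantify qs n p) \<longleftrightarrow> sat M e p"
  using assms(2)
proof (induction qs n p arbitrary: e rule: quantify.induct)
  case (2 qs n p)
  have "sat M (e(n := a)) (quantify qs (Suc n) p) \<longleftrightarrow> sat M e p" for a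
  proof -
    have "free_vars p \<subseteq> {..<Suc n}" using "2.prems" by auto
    then show ?thesis using 2 by (simp add: sat_fun_upd_fresh)
  qed
  then show ?case using assms(1) by auto
next
  case (3 qs n p)
  have "sat M (e(n := a)) (quantify qs (Suc n) p) \<longleftrightarrow> sat M e p" for a
  proof -
    have "free_vars p \<subseteq> {..<Suc n}" using "3.prems" by auto
    then show ?thesis using 3 by (simp add: sat_fun_upd_fresh)
  qed
  then show ?case using assms(1) by auto
qed simp

text \<open>Quantifiers added at the inner end bind variables that do not occur in \<open>p\<close>,
  so they are vacuous over a nonempty universe. This pads prefixes to a common length.\<close>

lemma sat_quantify_append:
  assumes "universe M \<noteq> {}" "free_vars p \<subseteq> {..<n + length qs}"
  shows "sat M e (quantify (qs @ qs') n p) \<longleftrightarrow> sat M e (quantify qs n p)"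
  using assms(2)
  by (induction qs n p arbitrary: e rule: quantify.induct)
    (simp_all add: sat_quantify_fresh assms(1))

fun dual :: "quant \<Rightarrow> quant" where
  "dual Exists = Forall"
| "dual Forall = Exists"

lemma sat_quantify_Neg:
  "sat M e (quantify (map dual qs) n (Neg p)) \<longleftrightarrow> \<not> sat M e (quantify qs n p)"
  by (induction qs n p arbitrary: e rule: quantify.induct) auto

text \<open>\<open>c\<close> mentions only variables fixed outside the prefix, so its truth is
  settled before the prefix is evaluated. Hence two subgoals can share one prefix at no cost in
  quantifiers.\<close>

lemma sat_quantify_If:
  assumes "universe M \<noteq> {}" "free_vars c \<subseteq> {..<n}"
  shows "sat M e (quantify qs n (Disj (Conj c p) (Conj (Neg c) q))) \<longleftrightarrow>
    (if sat M e c then sat M e (quantify qs n p) else sat M e (quantify qs n q))"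
  using assms(2)
proof (induction qs n p arbitrary: e rule: quantify.induct)
  case (2 qs n p)
  then have "free_vars c \<subseteq> {..<Suc n}" by auto
  then show ?case using 2 assms(1) by (simp add: sat_fun_upd_fresh)
next
  case (3 qs n p)
  then have "free_vars c \<subseteq> {..<Suc n}" by auto
  then show ?case using 3 assms(1) by (simp add: sat_fun_upd_fresh)
qed auto

text \<open>\<open>P\<close> is a property of the structure \<open>L m\<close> and of the values of the variables \<open>0, \<dots>, n - 1\<close>;
  the prefix binds \<open>n, n + 1, \<dots>\<close>, so that formulas with equal prefixes have equal bound variables.\<close>

definition expressible :: "quant list \<Rightarrow> nat \<Rightarrow> (nat \<Rightarrow> (nat \<Rightarrow> nat) \<Rightarrow> bool) \<Rightarrow> bool" where
  "expressible qs n P \<longleftrightarrow> (\<exists>p. quantifier_free p \<and> free_vars p \<subseteq> {..<n + length qs} \<and>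
     (\<forall>m e. (\<forall>i. e i \<le> m) \<longrightarrow> (sat (L m) e (quantify qs n p) \<longleftrightarrow> P m e)))"

lemma expressible_cong:
  assumes "expressible qs n P" "\<And>m e. (\<And>i. e i \<le> m) \<Longrightarrow> P m e \<longleftrightarrow> Q m e"
  shows "expressible qs n Q"
proof -
  obtain p where "quantifier_free p" "free_vars p \<subseteq> {..<n + length qs}"
    "\<And>m e. \<forall>i. e i \<le> m \<Longrightarrow> sat (L m) e (quantify qs n p) \<longleftrightarrow> P m e"
    using assms(1) unfolding expressible_def by blast
  then show ?thesis unfolding expressible_def using assms(2) by (intro exI[of _ p]) auto
qed

lemma expressible_append: "expressible qs n P \<Longrightarrow> expressible (qs @ qs') n P"
proof -
  assume "expressible qs n P"
  then obtain p where p: "quantifier_free p" "free_vars p \<subseteq> {..<n + length qs}"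
    "\<And>m e. \<forall>i. e i \<le> m \<Longrightarrow> sat (L m) e (quantify qs n p) \<longleftrightarrow> P m e"
    unfolding expressible_def by blast
  have "sat (L m) e (quantify (qs @ qs') n p) \<longleftrightarrow> sat (L m) e (quantify qs n p)" for m e
    by (rule sat_quantify_append) (use p in auto)
  then show ?thesis unfolding expressible_def using p by (intro exI[of _ p]) auto
qed

lemma expressible_const: "expressible qs n (\<lambda>m e. b)"
proof -
  have "expressible [] n (\<lambda>m e. b)" unfolding expressible_def
    by (rule exI[of _ "if b then Eq MinC MinC else Neg (Eq MinC MinC)"]) simp
  then show ?thesis using expressible_append by fastforce
qed

lemma expressible_dual:
  "expressible qs n P \<Longrightarrow> expressible (map dual qs) n (\<lambda>m e. \<not> P m e)"
  unfolding expressible_def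
  by (elim exE, rule_tac x = "Neg p" in exI) (simp add: sat_quantify_Neg)

lemma expressible_If:
  assumes "quantifier_free c" "free_vars c \<subseteq> {..<n}" "expressible qs n P" "expressible qs n Q"
  shows "expressible qs n (\<lambda>m e. if sat (L m) e c then P m e else Q m e)"
proof -
  obtain p where p: "quantifier_free p" "free_vars p \<subseteq> {..<n + length qs}"
    "\<And>m e. \<forall>i. e i \<le> m \<Longrightarrow> sat (L m) e (quantify qs n p) \<longleftrightarrow> P m e"
    using assms(3) unfolding expressible_def by blast
  obtain q where q: "quantifier_free q" "free_vars q \<subseteq> {..<n + length qs}"
    "\<And>m e. \<forall>i. e i \<le> m \<Longrightarrow> sat (L m) e (quantify qs n q) \<longleftrightarrow> Q m e"
    using assms(4) unfolding expressible_def by blast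
  have *: "sat (L m) e (quantify qs n (Disj (Conj c p) (Conj (Neg c) q))) \<longleftrightarrow>
    (if sat (L m) e c then sat (L m) e (quantify qs n p) else sat (L m) e (quantify qs n q))" for m e
    by (rule sat_quantify_If) (use assms in auto)
  show ?thesis unfolding expressible_def
    by (rule exI[of _ "Disj (Conj c p) (Conj (Neg c) q)"]) (use p q assms * in auto)
qed

lemma expressible_Ex:
  assumes "expressible qs (Suc n) P"
  shows "expressible (Exists # qs) n (\<lambda>m e. \<exists>a\<le>m. P m (e(n := a)))"
  using assms unfolding expressible_def by (elim exE, rule_tac x = p in exI) auto

lemma expressible_All:
  assumes "expressible qs (Suc n) P"
  shows "expressible (Forall # qs) n (\<lambda>m e. \<forall>a\<le>m. P m (e(n := a)))"
  using assms unfolding expressible_def by (elim exE, rule_tac x = p in exI) auto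

lemma sentence_of_expressible:
  assumes "expressible qs 0 (\<lambda>m e. P m)"
  obtains p where "sentence p" "prenex p" "qprefix p = qs" "\<And>m. models (L m) p \<longleftrightarrow> P m"
proof -
  obtain p where p: "quantifier_free p" "free_vars p \<subseteq> {..<length qs}"
    "\<And>m e. \<forall>i. e i \<le> m \<Longrightarrow> sat (L m) e (quantify qs 0 p) \<longleftrightarrow> P m"
    using assms unfolding expressible_def by auto
  show thesis
  proof
    show s: "sentence (quantify qs 0 p)"
      using p(2) by (auto simp: sentence_def free_vars_quantify)
    show "prenex (quantify qs 0 p)" "qprefix (quantify qs 0 p) = qs"
      using p(1) by (simp_all add: prenex_def matrix_quantify matrix_quantifier_free
          qprefix_quantify qprefix_quantifier_free)
    show "models (L m) (quantify qs 0 p) \<longleftrightarrow> P m" for m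
      using models_iff_sat[OF s, of "\<lambda>_. 0" "L m"] p(3)[of "\<lambda>_. 0" m] by auto
  qed
qed

section \<open>Bounds on distances\<close>

text \<open>Growth is at the outer end, so that the innermost quantifier is always universal; the
  outermost one is universal for odd and existential for positive even lengths.\<close>

fun alt_prefix :: "nat \<Rightarrow> quant list" where
  "alt_prefix 0 = []"
| "alt_prefix (Suc k) = (if even k then Forall else Exists) # alt_prefix k"

text \<open>The values are 0, 1, 2, 5, 10, 21, ...; a new outermost universal quantifier gains the
  extra 1.\<close>

fun capacity :: "nat \<Rightarrow> nat" where
  "capacity 0 = 0"
| "capacity (Suc k) = (if even k then 2 * capacity k + 1 else 2 * capacity k)"

lemma length_alt_prefix: "length (alt_prefix k) = k"
  by (induction k) auto

lemma alt_prefix_nonempty: "k \<ge> 1 \<Longrightarrow> alt_prefix k \<noteq> []"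
  by (cases k) auto

lemma last_alt_prefix: "k \<ge> 1 \<Longrightarrow> last (alt_prefix k) = Forall"
proof (induction k)
  case (Suc k)
  then show ?case by (cases k) auto
qed simp

lemma alternating_alt_prefix: "alternating (alt_prefix k)"
  unfolding alternating_def
proof (induction k)
  case (Suc k)
  then show ?case by (cases k) auto
qed simp

text \<open>A negated upper bound has the dual prefix, and one vacuous universal quantifier at the
  end gives it the required form. This is the price of a lower bound.\<close>

lemma alt_prefix_Suc_dual: "alt_prefix (Suc k) = map dual (alt_prefix k) @ [Forall]"
proof (induction k)
  case (Suc k)
  have "alt_prefix (Suc (Suc k)) = (if odd k then Forall else Exists) # map dual (alt_prefix k) @ [Forall]"
    by (simp only: alt_prefix.simps(2)[of "Suc k"] Suc.IH even_Suc)
  also have "\<dots> = map dual (alt_prefix (Suc k)) @ [Forall]"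
    by simp
  finally show ?case .
qed simp

lemma capacity_Suc_le: "capacity k \<le> capacity (Suc k)"
  by simp

text \<open>The game state after a universal, resp. an existential, move. The guard on \<open>z\<close> leaves room
  for a witness on either side of \<open>z\<close>.\<close>

definition split_disj :: "trm \<Rightarrow> trm \<Rightarrow> trm \<Rightarrow> nat \<Rightarrow> nat \<Rightarrow> nat \<Rightarrow> (nat \<Rightarrow> nat) \<Rightarrow> bool" where
  "split_disj s z t g h m e \<longleftrightarrow> (val (L m) e s < val (L m) e z \<and> val (L m) e z < val (L m) e t \<longrightarrow>
     val (L m) e z \<le> val (L m) e s + g \<or> val (L m) e t \<le> val (L m) e z + h)"

definition split_conj :: "trm \<Rightarrow> trm \<Rightarrow> trm \<Rightarrow> nat \<Rightarrow> nat \<Rightarrow> nat \<Rightarrow> (nat \<Rightarrow> nat) \<Rightarrow> bool" where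
  "split_conj s w t a b m e \<longleftrightarrow>
     val (L m) e w \<le> val (L m) e s + a \<and> val (L m) e t \<le> val (L m) e w + b"

text \<open>The side of \<open>z\<close> on which \<open>w\<close> is chosen declares which disjunct
  is claimed, and \<open>w\<close> serves as a midpoint for that one.\<close>

lemma bound_disj_iff_ex:
  fixes s z t m :: nat
  assumes "s < z" "z < t" "t \<le> m"
  shows "(z \<le> s + g \<or> t \<le> z + h) \<longleftrightarrow>
    (\<exists>w\<le>m. if w < z then w \<le> s + g div 2 \<and> z \<le> w + (g - g div 2)
           else w \<le> z + h div 2 \<and> t \<le> w + (h - h div 2))" (is "_ \<longleftrightarrow> ?R")
proof
  assume "z \<le> s + g \<or> t \<le> z + h"
  then show ?R
  proof
    assume "z \<le> s + g"
    \<comment> \<open>The midpoint is capped at \<open>z - 1\<close> to stay in the first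
      branch.\<close>
    then show ?R using assms by (intro exI[of _ "min (s + g div 2) (z - 1)"]) auto
  next
    assume "t \<le> z + h"
    \<comment> \<open>The cap \<open>m\<close> keeps the midpoint in the universe; it is still at
      least \<open>z\<close>, since \<open>z < t\<close> and \<open>t \<le> m\<close>.\<close>
    then show ?R using assms by (intro exI[of _ "min (z + h div 2) m"]) auto
  qed
next
  assume ?R
  then show "z \<le> s + g \<or> t \<le> z + h" by (auto split: if_splits)
qed

lemma bound_iff_ex:
  fixes s t m :: nat
  assumes "t \<le> m"
  shows "t \<le> s + h \<longleftrightarrow> (\<exists>w\<le>m. w \<le> s + h div 2 \<and> t \<le> w + (h - h div 2))"
proof
  assume "t \<le> s + h"
  then show "\<exists>w\<le>m. w \<le> s + h div 2 \<and> t \<le> w + (h - h div 2)"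
    using assms by (intro exI[of _ "min (s + h div 2) m"]) auto
qed auto

lemma bound_iff_all:
  fixes s t m :: nat
  assumes "t \<le> m" "h \<ge> 1"
  shows "t \<le> s + h \<longleftrightarrow>
    (\<forall>u\<le>m. s < u \<and> u < t \<longrightarrow> u \<le> s + h div 2 \<or> t \<le> u + (h - 1 - h div 2))"
proof
  assume *: "\<forall>u\<le>m. s < u \<and> u < t \<longrightarrow> u \<le> s + h div 2 \<or> t \<le> u + (h - 1 - h div 2)"
  show "t \<le> s + h"
  proof (rule ccontr)
    assume "\<not> t \<le> s + h"
    \<comment> \<open>The point just past the first half violates both disjuncts, and this
      inequality places it below \<open>t\<close>. Stepping past the half is what gains 1 over the
      sum of the two halves.\<close>
    moreover have "h div 2 + 1 \<le> h" using assms(2) by linarith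
    ultimately show False using assms(1) *[rule_format, of "s + h div 2 + 1"] by auto
  qed
qed auto

text \<open>The side of \<open>w\<close> on which \<open>u\<close> lies tells which conjunct is
  challenged; the guards make the implication for the other one vacuous.\<close>

lemma bound_conj_iff_all:
  fixes s w t m :: nat
  assumes "w \<le> m" "t \<le> m" "1 \<le> a" "1 \<le> b"
  shows "w \<le> s + a \<and> t \<le> w + b \<longleftrightarrow>
    (\<forall>u\<le>m. if u < w then s < u \<and> u < w \<longrightarrow> u \<le> s + a div 2 \<or> w \<le> u + (a - 1 - a div 2)
           else w < u \<and> u < t \<longrightarrow> u \<le> w + b div 2 \<or> t \<le> u + (b - 1 - b div 2))"
proof -
  have *: "(if u < w then s < u \<and> u < w \<longrightarrow> X else w < u \<and> u < t \<longrightarrow> Y) \<longleftrightarrow>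
      (s < u \<and> u < w \<longrightarrow> X) \<and> (w < u \<and> u < t \<longrightarrow> Y)" for u X Y
    by auto
  then show ?thesis
    unfolding bound_iff_all[OF assms(1,3)] bound_iff_all[OF assms(2,4)] * by blast
qed

lemma expressible_split_disj_step:
  assumes conj: "\<And>n s w t a b. vars_trm s \<union> vars_trm w \<union> vars_trm t \<subseteq> {..<n} \<Longrightarrow>
      a \<le> c \<Longrightarrow> b \<le> c \<Longrightarrow> expressible qs n (split_conj s w t a b)"
    and vars: "vars_trm s \<union> vars_trm z \<union> vars_trm t \<subseteq> {..<n}"
    and "g \<le> 2 * c" "h \<le> 2 * c"
  shows "expressible (Exists # qs) n (split_disj s z t g h)"
proof -
  let ?w = "Var n"
  have "expressible qs (Suc n) (\<lambda>m e. if sat (L m) e (Less ?w z)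
      then split_conj s ?w z (g div 2) (g - g div 2) m e
      else split_conj z ?w t (h div 2) (h - h div 2) m e)"
    by (rule expressible_If; (rule conj)?) (use vars assms(3,4) in auto)
  \<comment> \<open>Where the guard \<open>s < z < t\<close> fails, \<open>split_disj\<close> holds
    trivially. The guard does not involve the new variable, so it is tested outside the
    prefix.\<close>
  note expressible_If[OF _ _ expressible_Ex[OF this] expressible_const[where b = True],
      of "Conj (Less s z) (Less z t)"]
  then show ?thesis
  proof (rule expressible_cong, goal_cases)
    case (3 m e)
    have "val (L m) e t \<le> m" using 3 by (simp add: val_L_le)
    then show ?case using vars
      by (auto simp: split_disj_def split_conj_def bound_disj_iff_ex cong: if_cong)
  qed (use vars in auto)
qed

lemma expressible_split_conj_step_pos:
  assumes disj: "\<And>n s z t g h. vars_trm s \<union> vars_trm z \<union> vars_trm t \<subseteq> {..<n} \<Longrightarrow>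
      g \<le> c \<Longrightarrow> h \<le> c \<Longrightarrow> expressible qs n (split_disj s z t g h)"
    and vars: "vars_trm s \<union> vars_trm w \<union> vars_trm t \<subseteq> {..<n}"
    and "1 \<le> a" "a \<le> 2 * c + 1" "1 \<le> b" "b \<le> 2 * c + 1"
  shows "expressible (Forall # qs) n (split_conj s w t a b)"
proof -
  let ?u = "Var n"
  \<comment> \<open>The two halves sum to one less than the bound, so even \<open>2 * c + 1\<close>
    splits into halves of at most \<open>c\<close>.\<close>
  have half: "a div 2 \<le> c" "a - 1 - a div 2 \<le> c" "b div 2 \<le> c" "b - 1 - b div 2 \<le> c"
    using assms(4,6) by simp_all
  have "expressible qs (Suc n) (\<lambda>m e. if sat (L m) e (Less ?u w)
      then split_disj s ?u w (a div 2) (a - 1 - a div 2) m e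
      else split_disj w ?u t (b div 2) (b - 1 - b div 2) m e)"
    by (rule expressible_If; (rule disj)?) (use vars half in auto)
  note expressible_All[OF this]
  then show ?thesis
  proof (rule expressible_cong, goal_cases)
    case (1 m e)
    have "val (L m) e w \<le> m" "val (L m) e t \<le> m" using 1 by (simp_all add: val_L_le)
    note bound_conj_iff_all[OF this assms(3,5), of "val (L m) e s"]
    then show ?case unfolding split_conj_def split_disj_def using vars
      by (simp cong: if_cong)
  qed
qed

lemma expressible_split_conj_step:
  assumes disj: "\<And>n s z t g h. vars_trm s \<union> vars_trm z \<union> vars_trm t \<subseteq> {..<n} \<Longrightarrow>
      g \<le> c \<Longrightarrow> h \<le> c \<Longrightarrow> expressible qs n (split_disj s z t g h)"
    and vars: "vars_trm s \<union> vars_trm w \<union> vars_trm t \<subseteq> {..<n}"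
    and "a \<le> 2 * c + 1" "b \<le> 2 * c + 1"
  shows "expressible (Forall # qs) n (split_conj s w t a b)"
proof -
  have pos: "expressible (Forall # qs) n (split_conj s w t (max a 1) (max b 1))"
    by (rule expressible_split_conj_step_pos[OF disj vars]) (use assms(3,4) in auto)
  \<comment> \<open>A bound by \<open>0\<close> is quantifier free, and it can be added to the bound by \<open>1\<close>.\<close>
  let ?c = "Conj (if a = 0 then Neg (Less s w) else Eq MinC MinC)
    (if b = 0 then Neg (Less w t) else Eq MinC MinC)"
  have "expressible (Forall # qs) n
      (\<lambda>m e. if sat (L m) e ?c then split_conj s w t (max a 1) (max b 1) m e else False)"
    by (rule expressible_If[OF _ _ pos expressible_const]) (use vars in auto)
  then show ?thesis
    by (rule expressible_cong) (cases "a = 0"; cases "b = 0"; auto simp: split_conj_def max_def)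
qed

text \<open>The state fits the next quantifier: an existential one selects a disjunct, a universal
  one challenges a conjunct. Each move turns one kind of state into the other.\<close>

lemma expressible_split:
  assumes "vars_trm s \<union> vars_trm x \<union> vars_trm t \<subseteq> {..<n}" "a \<le> capacity k" "b \<le> capacity k"
  shows "expressible (alt_prefix k) n (if even k then split_disj s x t a b else split_conj s x t a b)"
  using assms
proof (induction k arbitrary: s x t n a b)
  case 0
  \<comment> \<open>With both bounds 0 the disjunction contradicts its guard, so only the negated
    guard is left.\<close>
  have "expressible [] n (split_disj s x t 0 0)" unfolding expressible_def
    by (rule exI[of _ "Neg (Conj (Less s x) (Less x t))"]) (use 0 in \<open>auto simp: split_disj_def\<close>)
  then show ?case using 0 by simp
next
  case (Suc k)
  show ?case
  proof (cases "even k")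
    case True
    then have "expressible (Forall # alt_prefix k) n (split_conj s x t a b)"
      by (intro expressible_split_conj_step[of "capacity k"]) (use Suc in auto)
    then show ?thesis using True by simp
  next
    case False
    then have "expressible (Exists # alt_prefix k) n (split_disj s x t a b)"
      by (intro expressible_split_disj_step[of "capacity k"]) (use Suc in auto)
    then show ?thesis using False by simp
  qed
qed

lemma expressible_le:
  assumes "k \<ge> 1" "h \<le> capacity k" and vars: "vars_trm s \<union> vars_trm t \<subseteq> {..<n}"
  shows "expressible (alt_prefix k) n (\<lambda>m e. val (L m) e t \<le> val (L m) e s + h)"
proof (cases "even k")
  case False
  \<comment> \<open>With \<open>t\<close> itself as the middle point, the second conjunct is
    trivial.\<close>
  have "expressible (alt_prefix k) n (split_conj s t t h 0)"
    using expressible_split[of s t t n h k 0] assms False by auto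
  then show ?thesis by (rule expressible_cong) (simp add: split_conj_def)
next
  case True
  then obtain j where j: "k = Suc j" "odd j" using assms(1) by (cases k) auto
  \<comment> \<open>The leading existential quantifier names a midpoint, leaving a conjunction for
    \<open>alt_prefix j\<close>.\<close>
  have "h div 2 \<le> capacity j" "h - h div 2 \<le> capacity j"
    using assms(2) j by simp_all
  moreover have "vars_trm s \<union> vars_trm (Var n) \<union> vars_trm t \<subseteq> {..<Suc n}"
    using vars by auto
  ultimately have "expressible (alt_prefix j) (Suc n) (split_conj s (Var n) t (h div 2) (h - h div 2))"
    using expressible_split[of s "Var n" t "Suc n" "h div 2" j "h - h div 2"] j(2) by simp
  note expressible_Ex[OF this]
  then show ?thesis unfolding j(1) using j(2)
  proof (simp, elim expressible_cong, goal_cases)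
    case (1 m e)
    have "val (L m) e t \<le> m" using 1 by (simp add: val_L_le)
    then show ?case using vars bound_iff_ex by (simp add: split_conj_def)
  qed
qed

lemma expressible_gt:
  assumes "k \<ge> 1" "h \<le> capacity k" "vars_trm s \<union> vars_trm t \<subseteq> {..<n}"
  shows "expressible (alt_prefix (Suc k)) n (\<lambda>m e. val (L m) e s + h < val (L m) e t)"
  unfolding alt_prefix_Suc_dual
  by (rule expressible_append, rule expressible_cong[OF expressible_dual[OF expressible_le]])
    (use assms in auto)

section \<open>The number of quantifiers\<close>

text \<open>The slack of 1 strengthens the induction. An odd value of \<open>q_exists\<close> gets
  it from the \<open>+ 1\<close> in \<open>capacity\<close>; the next universal step, where
  \<open>capacity\<close> only doubles, needs it because \<open>n div 2\<close> rounds down. The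
  base value at 2 is tight.\<close>

lemma q_le_capacity:
  "l \<ge> 1 \<Longrightarrow> l + (if even (q_forall l) \<and> l \<noteq> 2 then 1 else 0) \<le> capacity (q_forall l)"
  "l \<ge> 1 \<Longrightarrow> l + (if odd (q_exists l) then 1 else 0) \<le> capacity (q_exists l)"
proof (induction l and l rule: q_forall_q_exists.induct)
  case (1 n)
  show ?case
  proof (cases "n \<le> 2")
    case True
    then have "n = 1 \<or> n = 2" using 1 by auto
    then show ?thesis by (auto simp: q_forall.simps numeral_2_eq_2)
  next
    case False
    then have "q_forall n = Suc (q_exists (n div 2))" by (simp add: q_forall.simps)
    moreover have "n div 2 + (if odd (q_exists (n div 2)) then 1 else 0)
        \<le> capacity (q_exists (n div 2))"
      using 1 False by simp
    ultimately show ?thesis by (auto split: if_splits)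
  qed
next
  case (2 n)
  show ?case
  proof (cases "n = 1")
    case True
    then show ?thesis by (auto simp: q_exists.simps numeral_2_eq_2)
  next
    case False
    then have "q_exists n = Suc (q_forall ((n + 1) div 2))" using 2 by (simp add: q_exists.simps)
    moreover have "(n + 1) div 2 \<le> capacity (q_forall ((n + 1) div 2))"
      using 2 False by (force split: if_splits)
    ultimately show ?thesis
      using 2 False by (auto split: if_splits)
  qed
qed

text \<open>One halving undoes one step of \<open>capacity\<close>: \<open>l \<le> 2 * c + 1\<close>
  gives \<open>l div 2 \<le> c\<close>, and \<open>l \<le> 2 * c\<close> gives
  \<open>(l + 1) div 2 \<le> c\<close>. These are the roundings in \<open>q_forall\<close> and
  \<open>q_exists\<close>.\<close>

lemma q_minimal:
  assumes "l \<ge> 1" "l \<le> capacity k"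
  shows "if even k then q_exists l \<le> k else q_forall l \<le> k"
  using assms
proof (induction k arbitrary: l)
  case (Suc k)
  show ?case
  proof (cases "even k")
    case True
    show ?thesis
    proof (cases "l \<le> 2")
      case l: True
      then show ?thesis using Suc.prems True by (cases k) (auto simp: q_forall.simps)
    next
      case False
      then have "q_exists (l div 2) \<le> k" using Suc True by auto
      then show ?thesis using False True by (simp add: q_forall.simps)
    qed
  next
    case False
    show ?thesis
    proof (cases "l = 1")
      case l: True
      then show ?thesis using False by (cases k) (auto simp: q_exists.simps)
    next
      case l: False
      have "q_forall ((l + 1) div 2) \<le> k"
        using Suc.IH[of "(l + 1) div 2"] Suc.prems False l by auto
      then show ?thesis using False l Suc.prems by (simp add: q_exists.simps)
    qed
  qed
qed simp

lemma le_capacity_q_star: "l \<ge> 1 \<Longrightarrow> l \<le> capacity (q_star l)"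
  using q_le_capacity[of l] by (auto simp: q_star_def min_def split: if_splits)

lemma q_star_le: "l \<ge> 1 \<Longrightarrow> l \<le> capacity k \<Longrightarrow> q_star l \<le> k"
  using q_minimal[of l k] by (auto simp: q_star_def split: if_splits)

lemma q_star_pos: "l \<ge> 1 \<Longrightarrow> q_star l \<ge> 1"
  using le_capacity_q_star[of l] by (cases "q_star l") auto

text \<open>The correction for even \<open>k\<close> is forced by \<open>capacity 0 = 0\<close>; the
  universal step that follows absorbs it.\<close>

lemma two_power_le_capacity: "2 ^ k \<le> 2 * capacity k + (if even k then 1 else 0)"
  by (induction k) auto

lemma q_star_le_log:
  assumes "l \<ge> 1"
  shows "real (q_star l) \<le> log 2 (real l) + 2"
proof -
  obtain k where k: "q_star l = Suc k" using q_star_pos[OF assms] by (cases "q_star l") auto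
  \<comment> \<open>Minimality of \<open>q_star l\<close>: one quantifier fewer does not reach
    \<open>l\<close>.\<close>
  have "capacity k < l" using q_star_le[OF assms, of k] k by (rule_tac ccontr) simp
  then have "2 ^ k \<le> 2 * l" using two_power_le_capacity[of k] by (simp split: if_splits)
  then have "real (2 ^ k) \<le> real (2 * l)" using of_nat_le_iff by blast
  then have "2 ^ k \<le> 2 * real l" by simp
  then have "real k \<le> log 2 (2 * real l)" using le_log_of_power[of 2 k "2 * real l"] by simp
  then show ?thesis using k assms by (simp add: log_mult)
qed

section \<open>Exact lengths\<close>

text \<open>\<open>x\<close> challenges one of the two bounds; \<open>m \<ge> 1\<close> ensures that
  a nonzero \<open>x\<close> exists to challenge the lower one.\<close>

lemma exact_length_iff_all:
  assumes "m \<ge> 1" "l \<ge> 1"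
  shows "(\<forall>x\<le>m. if x = 0 then m \<le> l else l - 1 < m) \<longleftrightarrow> m = (l :: nat)"
proof
  assume *: "\<forall>x\<le>m. if x = 0 then m \<le> l else l - 1 < m"
  show "m = l" using *[rule_format, of 0] *[rule_format, of m] assms by simp
qed (use assms in auto)

text \<open>\<open>x\<close> cuts the order in two, and \<open>y\<close> below, at or above
  \<open>x\<close> challenges the lower bound on the left part, the upper bound on the whole, or the
  lower bound on the right part. The two lower bounds add up to \<open>m \<ge> l\<close>.\<close>

lemma exact_length_iff_ex:
  assumes "l \<ge> 2"
  shows "(\<exists>x\<le>m. 0 < x \<and> x < m \<and> (\<forall>y\<le>m. if y < x then l div 2 - 1 < x
      else if y = x then m \<le> l else x + (l - l div 2 - 1) < m)) \<longleftrightarrow> m = (l :: nat)"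
    (is "(\<exists>x\<le>m. ?P x) \<longleftrightarrow> _")
proof
  assume "\<exists>x\<le>m. ?P x"
  then obtain x where x: "0 < x" "x < m" and *: "\<And>y. y \<le> m \<Longrightarrow> if y < x then l div 2 - 1 < x
      else if y = x then m \<le> l else x + (l - l div 2 - 1) < m"
    by blast
  \<comment> \<open>As \<open>0 < x < m\<close>, the points 0, \<open>x\<close> and \<open>m\<close>
    realise all three challenges.\<close>
  show "m = l" using x *[of 0] *[of x] *[of m] assms by auto
next
  assume "m = l"
  then show "\<exists>x\<le>m. ?P x" using assms by (intro exI[of _ "l div 2"]) auto
qed

lemma expressible_exact_length:
  assumes "l \<ge> 1" "k \<ge> 1" "l \<le> capacity k"
  shows "\<exists>P. expressible (alt_prefix (k + 2)) 0 (\<lambda>m e. P m) \<and> (\<forall>m\<ge>1. P m \<longleftrightarrow> m = l)"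
proof (cases "even k")
  case False
  \<comment> \<open>For odd \<open>k\<close> the outermost variable is universal and picks the
    bound; the \<open>k + 1\<close> quantifiers left are what a lower bound within
    \<open>capacity k\<close> takes.\<close>
  have "expressible (alt_prefix (Suc k)) 1 (\<lambda>m e. if sat (L m) e (Eq (Var 0) MinC)
      then val (L m) e MaxC \<le> val (L m) e MinC + l
      else val (L m) e MinC + (l - 1) < val (L m) e MaxC)"
    by (rule expressible_If[OF _ _ expressible_le expressible_gt])
      (use assms capacity_Suc_le[of k] in \<open>auto simp del: capacity.simps\<close>)
  note expressible_All[OF this[unfolded One_nat_def]]
  then have "expressible (Forall # alt_prefix (Suc k)) 0 (\<lambda>m e. \<forall>x\<le>m. if x = 0 then m \<le> l else l - 1 < m)"
    by (rule expressible_cong) (simp cong: if_cong)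
  moreover have "alt_prefix (k + 2) = Forall # alt_prefix (Suc k)"
    using False by simp
  ultimately show ?thesis
    using exact_length_iff_all[OF _ assms(1)]
    by (intro exI[of _ "\<lambda>m. \<forall>x\<le>m. if x = 0 then m \<le> l else l - 1 < m"]) simp
next
  case True
  then obtain j where j: "k = Suc j" "odd j" using assms(2) by (cases k) auto
  show ?thesis
  proof (cases "l = 1")
    case l: True
    \<comment> \<open>Length 1 has no point strictly inside to cut at, but among
      \<open>m \<ge> 1\<close> the upper bound alone singles it out.\<close>
    have "expressible (alt_prefix (k + 2)) 0 (\<lambda>m e. m \<le> l)"
      using expressible_le[of "k + 2" l MinC MaxC 0] assms(3) True by simp
    then show ?thesis using l by (intro exI[of _ "\<lambda>m. m \<le> l"]) auto
  next
    case False
    then have l: "l \<ge> 2" using assms(1) by simp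
    \<comment> \<open>Only \<open>k - 1\<close> quantifiers serve a lower bound here, and the capacity for them is half of
      that for \<open>k\<close>. So the first existential variable halves the lower bound.\<close>
    have j1: "j \<ge> 1" using j(2) by (cases j) auto
    have cap: "l \<le> 2 * capacity j" using assms(3) j by simp
    let ?x = "Var 0" and ?y = "Var 1"
    have gt1: "expressible (alt_prefix k) 2 (\<lambda>m e. val (L m) e MinC + (l div 2 - 1) < val (L m) e ?x)"
      unfolding j(1) by (rule expressible_gt) (use j1 cap in auto)
    have gt2: "expressible (alt_prefix k) 2 (\<lambda>m e. val (L m) e ?x + (l - l div 2 - 1) < val (L m) e MaxC)"
      unfolding j(1) by (rule expressible_gt) (use j1 cap in auto)
    have le: "expressible (alt_prefix k) 2 (\<lambda>m e. val (L m) e MaxC \<le> val (L m) e MinC + l)"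
      by (rule expressible_le) (use assms in auto)
    have inner: "expressible (alt_prefix k) (Suc 1) (\<lambda>m e. if sat (L m) e (Less ?y ?x)
        then val (L m) e MinC + (l div 2 - 1) < val (L m) e ?x
        else if sat (L m) e (Eq ?y ?x) then val (L m) e MaxC \<le> val (L m) e MinC + l
        else val (L m) e ?x + (l - l div 2 - 1) < val (L m) e MaxC)"
      unfolding Suc_1 by (rule expressible_If[OF _ _ gt1 expressible_If[OF _ _ le gt2]]) auto
    note expressible_All[OF inner]
    then have "expressible (Forall # alt_prefix k) (Suc 0) (\<lambda>m e. \<forall>y\<le>m. if y < e 0 then l div 2 - 1 < e 0
        else if y = e 0 then m \<le> l else e 0 + (l - l div 2 - 1) < m)"
      unfolding One_nat_def by (rule expressible_cong) (simp cong: if_cong)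
    note expressible_If[OF _ _ this expressible_const[where b = False],
        of "Conj (Less MinC ?x) (Less ?x MaxC)"]
    then have "expressible (Forall # alt_prefix k) (Suc 0) (\<lambda>m e. 0 < e 0 \<and> e 0 < m \<and>
        (\<forall>y\<le>m. if y < e 0 then l div 2 - 1 < e 0
          else if y = e 0 then m \<le> l else e 0 + (l - l div 2 - 1) < m))"
      by (rule expressible_cong) simp_all
    note expressible_Ex[OF this]
    then have "expressible (Exists # Forall # alt_prefix k) 0 (\<lambda>m e. m = l)"
      by (rule expressible_cong) (simp only: fun_upd_same exact_length_iff_ex[OF l])
    then show ?thesis using True by (intro exI[of _ "\<lambda>m. m = l"]) simp
  qed
qed

theorem theorem4p7:
  fixes l :: nat
  assumes "l \<ge> 1"
  shows "\<exists>\<phi>. sentence \<phi> \<and> prenex \<phi>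
           \<and> alternating (qprefix \<phi>)
           \<and> qprefix \<phi> \<noteq> [] \<and> last (qprefix \<phi>) = Forall
           \<and> length (qprefix \<phi>) = q_star l + 2
           \<and> real (length (qprefix \<phi>)) \<le> log 2 (real l) + 4
           \<and> models (L l) \<phi>
           \<and> (\<forall>m\<ge>1. m \<noteq> l \<longrightarrow> \<not> models (L m) \<phi>)"
proof -
  let ?k = "q_star l"
  obtain P where P: "expressible (alt_prefix (?k + 2)) 0 (\<lambda>m e. P m)" "\<And>m. m \<ge> 1 \<Longrightarrow> P m \<longleftrightarrow> m = l"
    using expressible_exact_length[OF assms q_star_pos le_capacity_q_star] assms by blast
  obtain p where p: "sentence p" "prenex p" "qprefix p = alt_prefix (?k + 2)"
    "\<And>m. models (L m) p \<longleftrightarrow> P m"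
    using sentence_of_expressible[OF P(1)] by blast
  show ?thesis
    by (rule exI[of _ p])
      (use p P(2) assms q_star_le_log[OF assms] alternating_alt_prefix[of "?k + 2"]
          alt_prefix_nonempty[of "?k + 2"] last_alt_prefix[of "?k + 2"] length_alt_prefix[of "?k + 2"]
        in \<open>simp del: alt_prefix.simps add_2_eq_Suc'\<close>)
qed

end
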